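(* Let $\mathcal{A}=\{A_1,\dots,A_m\}\subseteq\mathbb{R}^{n\times n}$ be a finite set of matrices. Then $\rho(\mathcal{A})<1$ if and only if there exists a contracting GE-$d$-norm for some nonnegative integer $d$; i.e., a function $V:\mathbb{R}^n\to\mathbb{R}$ of the form $V(x)=\max_{t\in[-1,1]}\sqrt{x^TP(t)x}$, where $P(t)$ is a univariate polynomial matrix (real symmetric $n\times n$, with entries polynomial in $t$) of degree $d$ satisfying $P(t)\succeq 0$ for all $t\in[-1,1]$ and $\bigcap_{t\in[-1,1]}\mathrm{Ker}(P(t))=\{0\}$, such that $V(Ax)<V(x)$ for all $x\ne 0$ and all $A\in\mathcal{A}$.
   Context: The joint spectral radius of $\mathcal{A}=\{A_1,\dots,A_m\}\subseteq\mathbb{R}^{n\times n}$ is $$\rho(\mathcal{A}):=\lim_{k\to\infty}\ \max_{\sigma\in\{1,\dots,m\}^k}\|A_{\sigma_k}\cdots A_{\sigma_1}\|^{1/k},$$ where $\|\cdot\|$ is any matrix norm (the value does not depend on the choice). *)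

theory Defs
  imports "HOL-Analysis.Analysis" "HOL-Computational_Algebra.Polynomial"
begin

text \<open>
  Any norm on the vector space of real square matrices. Submultiplicativity is not demanded, so
  the predicate also covers every choice of matrix norm in the narrower (submultiplicative) sense.
\<close>

definition matrix_norm :: "(real^'n^'n \<Rightarrow> real) \<Rightarrow> bool" where
  "matrix_norm N \<longleftrightarrow>
     (\<forall>M. 0 \<le> N M) \<and>
     (\<forall>M. N M = 0 \<longleftrightarrow> M = 0) \<and>
     (\<forall>c M. N (c *\<^sub>R M) = \<bar>c\<bar> * N M) \<and>
     (\<forall>M M'. N (M + M') \<le> N M + N M')"

text \<open>
  A word \<open>[B\<^sub>1, \<dots>, B\<^sub>k]\<close> is sent to the product \<open>B\<^sub>k ** \<dots> ** B\<^sub>1\<close>.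
\<close>

definition word_prod :: "(real^'n^'n) list \<Rightarrow> real^'n^'n" where
  "word_prod w = fold (\<lambda>B M. B ** M) w (mat 1)"

text \<open>
  For a finite nonempty \<open>\<A>\<close> the maximum is over a finite nonempty set. The term for \<open>k = 0\<close>, where
  \<open>root 0\<close> is constantly 0, does not affect the limit.
\<close>

definition joint_spectral_radius ::
    "(real^'n^'n \<Rightarrow> real) \<Rightarrow> (real^'n^'n) set \<Rightarrow> real" where
  "joint_spectral_radius N \<A> =
     lim (\<lambda>k. Max ((\<lambda>w. root k (N (word_prod w))) ` {w. set w \<subseteq> \<A> \<and> length w = k}))"

definition eval_mat :: "(real poly)^'n^'n \<Rightarrow> real \<Rightarrow> real^'n^'n" where
  "eval_mat P t = (\<chi> i j. poly (P $ i $ j) t)"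

definition mat_degree :: "(real poly)^'n^'n \<Rightarrow> nat" where
  "mat_degree P = Max {degree (P $ i $ j) | i j. True}"

definition pos_semidef :: "real^'n^'n \<Rightarrow> bool" where
  "pos_semidef M \<longleftrightarrow> transpose M = M \<and> (\<forall>x. 0 \<le> x \<bullet> (M *v x))"

definition mat_kernel :: "real^'n^'n \<Rightarrow> (real^'n) set" where
  "mat_kernel M = {x. M *v x = 0}"

text \<open>
  The supremum below is a maximum: a continuous function of \<open>t\<close> on a compact interval attains it.
\<close>

definition GE_norm :: "nat \<Rightarrow> (real^'n \<Rightarrow> real) \<Rightarrow> bool" where
  "GE_norm d V \<longleftrightarrow>
     (\<exists>P :: (real poly)^'n^'n.
        transpose P = P \<and>
        mat_degree P = d \<and>
        (\<forall>t\<in>{-1..1}. pos_semidef (eval_mat P t)) \<and>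
        (\<Inter>t\<in>{-1..1}. mat_kernel (eval_mat P t)) = {0} \<and>
        (\<forall>x. V x = (SUP t\<in>{-1..1}. sqrt (x \<bullet> (eval_mat P t *v x)))))"

definition contracting :: "(real^'n^'n) set \<Rightarrow> (real^'n \<Rightarrow> real) \<Rightarrow> bool" where
  "contracting \<A> V \<longleftrightarrow> (\<forall>A\<in>\<A>. \<forall>x. x \<noteq> 0 \<longrightarrow> V (A *v x) < V x)"

end

theory Submission
  imports Defs
begin

text \<open>
  Both sides are equivalent to exponential decay of long products: there are \<open>C\<close> and
  \<open>\<gamma> < 1\<close> such that every product of \<open>k\<close> matrices from \<open>\<A>\<close> has norm at most
  \<open>C * \<gamma> ^ k\<close>.

  For the spectral radius this is \<open>joint_spectral_radius_less_1_iff\<close>. Its substance is that the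
  limit in the definition exists: a suitable positive multiple of \<open>N\<close> is submultiplicative, so
  the maximal norms of products of length \<open>k\<close> form a submultiplicative sequence up to a constant
  factor, and Fekete's argument applies (\<open>submultiplicative_root_converges\<close>).

  A contracting GE-norm \<open>V\<close> gives decay by compactness: \<open>V\<close> is continuous and positively
  homogeneous, so strict contraction on the unit sphere by finitely many matrices is contraction by
  a uniform factor \<open>\<gamma> < 1\<close>, and \<open>V\<close> is comparable to the Euclidean norm
  (\<open>contracting_imp_exponential_decay\<close>).

  Conversely, decay yields a number \<open>s > 1\<close> and a length bound \<open>m\<close> for which the function
  \<open>W x = Max {s ^ length w * (norm (word_prod w *v x))\<^sup>2 | length w \<le> m}\<close>,
  with \<open>w\<close> ranging over the words in \<open>\<A>\<close>, satisfies
  \<open>W (A *v x) \<le> W x / s\<close> for all \<open>A \<in> \<A>\<close>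
  (\<open>exponential_decay_imp_max_of_quadratics\<close>). So \<open>W\<close> is a maximum of finitely many positive
  semidefinite quadratic forms \<open>Q\<^sub>w\<close>. To write it, nearly, as a maximum over \<open>t \<in> [-1, 1]\<close>
  of the forms of one polynomial matrix, take \<open>P(t) = (\<Sum>w. p\<^sub>w(t) Q\<^sub>w)\<close>, where the
  polynomials \<open>p\<^sub>w\<close> are nonnegative on \<open>[-1, 1]\<close>, have sum at most \<open>1 + \<epsilon>\<close> there, and each
  takes the value 1 somewhere (\<open>peaked_polynomials\<close>). Then
  \<open>W x \<le> (max\<^sub>t x\<^sup>T P(t) x) \<le> (1 + \<epsilon>) W x\<close>, and for \<open>1 + \<epsilon> < s\<close> the error is
  absorbed by the slack in the contraction of \<open>W\<close>.
\<close>

section \<open>Roots of submultiplicative sequences\<close>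

text \<open>
  Fekete's lemma in multiplicative form. If \<open>a m \<le> r ^ m\<close> for one \<open>m > 0\<close>, cutting \<open>n\<close> into
  blocks of length \<open>m\<close> and a remainder gives \<open>a n \<le> B * r ^ n\<close> for all \<open>n\<close>, and the \<open>n\<close>-th
  root of the constant \<open>B\<close> tends to 1.
\<close>

lemma submultiplicative_root_converges:
  fixes a :: "nat \<Rightarrow> real"
  assumes nonneg: "\<And>k. 0 \<le> a k"
    and submult: "\<And>j k. a (j + k) \<le> a j * a k"
  shows "(\<lambda>k. root k (a k)) \<longlonglongrightarrow> (INF k\<in>{0<..}. root k (a k))"
proof (rule order_tendstoI)
  let ?L = "INF k\<in>{0<..}. root k (a k)"
  have bdd: "bdd_below ((\<lambda>k. root k (a k)) ` {0<..})"
    by (rule bdd_belowI[of _ 0]) (auto simp: nonneg)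
  fix y
  {
    assume "y < ?L"
    then have "y < root k (a k)" if "0 < k" for k
      using cINF_lower[OF bdd, of k] that by auto
    then show "\<forall>\<^sub>F k in sequentially. y < root k (a k)"
      by (intro eventually_mono[OF eventually_gt_at_top[of 0]])
  next
    assume "?L < y"
    then obtain m where m: "0 < m" "root m (a m) < y"
      by (subst (asm) cINF_less_iff[OF _ bdd]) auto
    obtain r where r: "root m (a m) < r" "r < y"
      using dense m(2) by blast
    have "0 \<le> root m (a m)" using nonneg m(1) by (simp add: real_root_ge_zero)
    then have r0: "0 < r" using r by linarith
    have am: "a m \<le> r ^ m"
      using r(1) m(1) r0 nonneg[of m]
      by (metis less_imp_le real_root_less_iff real_root_pos2 not_le)
    have block: "a (q * m + s) \<le> r ^ (q * m) * a s" for q s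
    proof (induction q)
      case 0
      then show ?case by simp
    next
      case (Suc q)
      have "a (Suc q * m + s) \<le> a m * a (q * m + s)"
        using submult[of m "q * m + s"] by (simp add: add.assoc)
      also have "\<dots> \<le> r ^ m * (r ^ (q * m) * a s)"
        using am Suc nonneg r0 by (intro mult_mono) auto
      finally show ?case by (simp add: power_add algebra_simps)
    qed
    define B where "B = 1 + (\<Sum>s<m. a s / r ^ s)"
    have B: "0 < B"
      unfolding B_def using r0 nonneg by (intro add_pos_nonneg sum_nonneg) auto
    have bound: "a n \<le> B * r ^ n" for n
    proof -
      have "a n \<le> r ^ (n div m * m) * a (n mod m)"
        using block[of "n div m" "n mod m"] by simp
      also have "\<dots> = a (n mod m) / r ^ (n mod m) * r ^ n"
      proof -
        have "r ^ n = r ^ (n div m * m) * r ^ (n mod m)"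
          by (metis div_mult_mod_eq power_add)
        then show ?thesis using r0 by simp
      qed
      also have "\<dots> \<le> B * r ^ n"
      proof (rule mult_right_mono)
        have "a (n mod m) / r ^ (n mod m) \<le> (\<Sum>s<m. a s / r ^ s)"
          using m(1) r0 nonneg by (intro member_le_sum) auto
        then show "a (n mod m) / r ^ (n mod m) \<le> B" by (simp add: B_def)
      qed (use r0 in simp)
      finally show ?thesis .
    qed
    have "(\<lambda>n. root n B * r) \<longlonglongrightarrow> 1 * r"
      by (intro tendsto_intros LIMSEQ_root_const B)
    then have "\<forall>\<^sub>F n in sequentially. root n B * r < y"
      using r(2) by (intro order_tendstoD(2)) auto
    then show "\<forall>\<^sub>F n in sequentially. root n (a n) < y"
      using eventually_gt_at_top[of 0]
    proof eventually_elim
      case (elim n)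
      have "root n (a n) \<le> root n (B * r ^ n)"
        using elim(2) bound by simp
      also have "\<dots> = root n B * r"
        using elim(2) r0 by (simp add: real_root_mult real_root_power_cancel)
      finally show ?case using elim(1) by simp
    qed
  }
qed

section \<open>Matrix norms\<close>

text \<open>
  Expansion in the basis gives the upper bound and the continuity of \<open>N\<close>; the lower constant is
  the minimum of \<open>N\<close> on the compact unit sphere.
\<close>

lemma norm_equivalent_to_euclidean:
  fixes N :: "'a::euclidean_space \<Rightarrow> real"
  assumes definite: "\<And>x. N x = 0 \<longleftrightarrow> x = 0"
    and nonneg: "\<And>x. 0 \<le> N x"
    and scale: "\<And>c x. N (c *\<^sub>R x) = \<bar>c\<bar> * N x"
    and triangle: "\<And>x y. N (x + y) \<le> N x + N y"
  obtains c C where "0 < c" "0 < C" "\<And>x. c * norm x \<le> N x" "\<And>x. N x \<le> C * norm x"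
proof -
  define C where "C = 1 + (\<Sum>b\<in>Basis. N (b::'a))"
  have C: "0 < C"
    unfolding C_def using nonneg by (intro add_pos_nonneg sum_nonneg) auto
  have sum_le: "N (sum f S) \<le> (\<Sum>i\<in>S. N (f i))" if "finite S" for f and S :: "'a set"
    using that
  proof (induction S rule: finite_induct)
    case empty
    show ?case using definite[of 0] by simp
  next
    case (insert i S)
    then show ?case using triangle[of "f i" "sum f S"] by simp
  qed
  have upper: "N x \<le> C * norm x" for x
  proof -
    have "N x = N (\<Sum>b\<in>Basis. (x \<bullet> b) *\<^sub>R b)" by (simp add: euclidean_representation)
    also have "\<dots> \<le> (\<Sum>b\<in>Basis. \<bar>x \<bullet> b\<bar> * N b)"
      using sum_le[of Basis "\<lambda>b. (x \<bullet> b) *\<^sub>R b"] by (simp add: scale)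
    also have "\<dots> \<le> (\<Sum>b\<in>Basis. norm x * N b)"
      by (intro sum_mono mult_right_mono Basis_le_norm nonneg)
    also have "\<dots> \<le> C * norm x"
      by (simp add: C_def algebra_simps sum_distrib_left)
    finally show ?thesis .
  qed
  have diff: "\<bar>N x - N y\<bar> \<le> C * norm (x - y)" for x y
  proof -
    have "N (y - x) = N (x - y)" using scale[of "-1" "x - y"] by simp
    then show ?thesis
      using triangle[of "x - y" y] triangle[of "y - x" x] upper[of "x - y"] by simp
  qed
  have "C-lipschitz_on UNIV N"
    using diff C by (intro lipschitz_onI) (auto simp: dist_norm)
  then have cont: "continuous_on (sphere 0 1) N"
    by (meson lipschitz_on_continuous_on continuous_on_subset subset_UNIV)
  obtain b :: 'a where "b \<in> Basis" using nonempty_Basis by blast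
  then have "sphere (0::'a) 1 \<noteq> {}" by (metis empty_iff mem_sphere_0 norm_Basis)
  then obtain u where u: "u \<in> sphere 0 1" "\<And>x. x \<in> sphere 0 1 \<Longrightarrow> N u \<le> N x"
    using continuous_attains_inf[OF compact_sphere _ cont] by blast
  have "0 < N u" using u(1) definite[of u] nonneg[of u] by fastforce
  moreover have "N u * norm x \<le> N x" for x
  proof (cases "x = 0")
    case True
    then show ?thesis using definite[of 0] by simp
  next
    case False
    then have "N u \<le> N ((1 / norm x) *\<^sub>R x)" by (intro u(2)) simp
    then show ?thesis using False by (simp add: scale field_simps)
  qed
  ultimately show ?thesis using that C upper by blast
qed

lemma matrix_norm_equivalent_to_euclidean:
  assumes "matrix_norm (N :: real^'n^'n \<Rightarrow> real)"
  obtains c C where "0 < c" "0 < C" "\<And>M. c * norm M \<le> N M" "\<And>M. N M \<le> C * norm M"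
  using assms norm_equivalent_to_euclidean[of N] unfolding matrix_norm_def by metis

lemma bilinear_matrix_matrix_mult:
  "bilinear ((**) :: real^'n^'m \<Rightarrow> real^'k^'n \<Rightarrow> real^'k^'m)"
  by (auto simp: bilinear_def matrix_matrix_mult_def vec_eq_iff sum.distrib sum_distrib_left
      algebra_simps intro!: linearI)

lemma bilinear_matrix_vector_mult:
  "bilinear ((*v) :: real^'n^'m \<Rightarrow> real^'n \<Rightarrow> real^'m)"
  by (auto simp: bilinear_def matrix_vector_mult_add_rdistrib
      matrix_vector_right_distrib scaleR_matrix_vector_assoc matrix_vector_mult_scaleR
      intro!: linearI)

text \<open>
  So \<open>K * N\<close> is submultiplicative, which is what makes the growth of products independent of the
  submultiplicativity of \<open>N\<close> itself.
\<close>

lemma matrix_norm_mult_bound: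
  assumes "matrix_norm (N :: real^'n^'n \<Rightarrow> real)"
  obtains K where "0 < K" "\<And>M M'. N (M ** M') \<le> K * N M * N M'"
proof -
  obtain c C where cC: "0 < c" "0 < C" "\<And>M. c * norm M \<le> N M" "\<And>M. N M \<le> C * norm M"
    using matrix_norm_equivalent_to_euclidean[OF assms] by blast
  obtain B where B: "0 < B" "\<And>(M::real^'n^'n) (M'::real^'n^'n). norm (M ** M') \<le> B * norm M * norm M'"
    using bilinear_bounded_pos[OF bilinear_matrix_matrix_mult] by metis
  have "N (M ** M') \<le> C * B / c\<^sup>2 * N M * N M'" for M M' :: "real^'n^'n"
  proof -
    have "N (M ** M') \<le> C * (B * norm M * norm M')"
      using cC(2) order_trans[OF cC(4)[of "M ** M'"] mult_left_mono[OF B(2)[of M M']]] by simp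
    also have "\<dots> = C * B / c\<^sup>2 * ((c * norm M) * (c * norm M'))"
      using cC(1) by (simp add: power2_eq_square)
    also have "\<dots> \<le> C * B / c\<^sup>2 * (N M * N M')"
      using cC B(1) order_trans[OF _ cC(3)] by (intro mult_left_mono mult_mono) auto
    finally show ?thesis by (simp add: mult.assoc)
  qed
  moreover have "0 < C * B / c\<^sup>2" using cC B(1) by simp
  ultimately show ?thesis using that by blast
qed

lemma matrix_norm_vector_mult_bound:
  assumes "matrix_norm (N :: real^'n^'n \<Rightarrow> real)"
  obtains K where "0 < K" "\<And>M x. norm (M *v x) \<le> K * N M * norm x"
proof -
  obtain c C where cC: "0 < c" "0 < C" "\<And>M. c * norm M \<le> N M" "\<And>M. N M \<le> C * norm M"
    using matrix_norm_equivalent_to_euclidean[OF assms] by blast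
  obtain B where B: "0 < B" "\<And>M (x::real^'n). norm ((M::real^'n^'n) *v x) \<le> B * norm M * norm x"
    using bilinear_bounded_pos[OF bilinear_matrix_vector_mult] by metis
  have "norm (M *v x) \<le> B / c * N M * norm x" for M :: "real^'n^'n" and x
  proof -
    have "norm (M *v x) \<le> B / c * (c * norm M) * norm x"
      using B(2)[of M x] cC(1) by simp
    also have "\<dots> \<le> B / c * N M * norm x"
      using cC B(1) by (intro mult_right_mono mult_left_mono) auto
    finally show ?thesis .
  qed
  moreover have "0 < B / c" using cC B(1) by simp
  ultimately show ?thesis using that by blast
qed

section \<open>The joint spectral radius and exponential decay of products\<close>

lemma word_prod_Nil [simp]: "word_prod [] = mat 1"
  by (simp add: word_prod_def)

lemma word_prod_snoc [simp]: "word_prod (w @ [B]) = B ** word_prod w"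
  by (simp add: word_prod_def)

lemma word_prod_append: "word_prod (u @ v) = word_prod v ** word_prod u"
proof (induction v rule: rev_induct)
  case (snoc B v)
  show ?case by (simp flip: append_assoc add: snoc matrix_mul_assoc)
qed simp

lemma word_prod_Cons: "word_prod (B # w) = word_prod w ** B"
  using word_prod_append[of "[B]" w] word_prod_snoc[of "[]" B] by simp

definition words :: "'a set \<Rightarrow> nat \<Rightarrow> 'a list set" where
  "words \<A> k = {w. set w \<subseteq> \<A> \<and> length w = k}"

lemma finite_words: "finite \<A> \<Longrightarrow> finite (words \<A> k)"
  by (simp add: words_def finite_lists_length_eq)

lemma words_nonempty:
  assumes "\<A> \<noteq> {}"
  shows "words \<A> k \<noteq> {}"
proof -
  obtain A where "A \<in> \<A>" using assms by blast
  then have "replicate k A \<in> words \<A> k" by (auto simp: words_def)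
  then show ?thesis by blast
qed

definition max_word_norm :: "(real^'n^'n \<Rightarrow> real) \<Rightarrow> (real^'n^'n) set \<Rightarrow> nat \<Rightarrow> real" where
  "max_word_norm N \<A> k = Max ((\<lambda>w. N (word_prod w)) ` words \<A> k)"

lemma Max_root_eq_root_max_word_norm:
  assumes "finite \<A>" "\<A> \<noteq> {}" "0 < k"
  shows "Max ((\<lambda>w. root k (N (word_prod w))) ` {w. set w \<subseteq> \<A> \<and> length w = k})
    = root k (max_word_norm N \<A> k)"
proof -
  have "mono (root k)" using assms(3) by (auto intro: monoI)
  then show ?thesis
    unfolding max_word_norm_def words_def[symmetric]
    using mono_Max_commute[of "root k" "(\<lambda>w. N (word_prod w)) ` words \<A> k"]
      finite_words[OF assms(1)] words_nonempty[OF assms(2)]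
    by (simp add: image_image)
qed

lemma max_word_norm_submultiplicative:
  assumes "finite \<A>" "\<A> \<noteq> {}" "matrix_norm N"
    and K: "0 < K" "\<And>M M'. N (M ** M') \<le> K * N M * N M'"
  shows "max_word_norm N \<A> (j + k) \<le> K * max_word_norm N \<A> j * max_word_norm N \<A> k"
proof -
  have nonneg: "0 \<le> N M" for M using assms(3) by (simp add: matrix_norm_def)
  have le: "N (word_prod w) \<le> max_word_norm N \<A> l" if "w \<in> words \<A> l" for w l
    unfolding max_word_norm_def using finite_words[OF assms(1)] that by (intro Max_ge) auto
  have "N (word_prod w) \<le> K * max_word_norm N \<A> j * max_word_norm N \<A> k"
    if "w \<in> words \<A> (j + k)" for w
  proof -
    have u: "take j w \<in> words \<A> j" and v: "drop j w \<in> words \<A> k"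
      using that set_take_subset[of j w] set_drop_subset[of j w] by (auto simp: words_def)
    have "N (word_prod w) \<le> K * N (word_prod (drop j w)) * N (word_prod (take j w))"
      using K(2) by (metis append_take_drop_id word_prod_append)
    also have "\<dots> \<le> K * max_word_norm N \<A> k * max_word_norm N \<A> j"
      using K(1) le[OF u] le[OF v] nonneg order_trans[OF nonneg le[OF v]]
      by (intro mult_mono) auto
    finally show ?thesis by (simp add: mult.commute mult.left_commute)
  qed
  then show ?thesis
    unfolding max_word_norm_def[of _ _ "j + k"]
    using finite_words[OF assms(1)] words_nonempty[OF assms(2)] by (intro Max.boundedI) auto
qed

text \<open>
  Existence of the limit in the definition of the joint spectral radius. With \<open>K\<close> from
  \<open>matrix_norm_mult_bound\<close> the sequence \<open>K * max_word_norm N \<A> k\<close> is submultiplicative, and the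
  \<open>k\<close>-th root of \<open>K\<close> tends to 1.
\<close>

lemma joint_spectral_radius_LIMSEQ:
  assumes "finite \<A>" "\<A> \<noteq> {}" "matrix_norm N"
  shows "(\<lambda>k. root k (max_word_norm N \<A> k)) \<longlonglongrightarrow> joint_spectral_radius N \<A>"
proof -
  let ?m = "max_word_norm N \<A>"
  obtain K where K: "0 < K" "\<And>M M'. N (M ** M') \<le> K * N M * N M'"
    using matrix_norm_mult_bound[OF assms(3)] by blast
  have m0: "0 \<le> ?m k" for k
  proof -
    obtain w where "w \<in> words \<A> k" using words_nonempty[OF assms(2)] by blast
    then have "N (word_prod w) \<le> ?m k"
      unfolding max_word_norm_def using finite_words[OF assms(1)] by (intro Max_ge) auto
    then show ?thesis using assms(3) by (meson matrix_norm_def order_trans)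
  qed
  obtain L where "(\<lambda>k. root k (K * ?m k)) \<longlonglongrightarrow> L"
  proof
    show "(\<lambda>k. root k (K * ?m k)) \<longlonglongrightarrow> (INF k\<in>{0<..}. root k (K * ?m k))"
    proof (rule submultiplicative_root_converges)
      show "K * ?m (j + k) \<le> K * ?m j * (K * ?m k)" for j k
        using mult_left_mono[OF max_word_norm_submultiplicative[OF assms K, of j k], of K] K(1)
        by (simp add: mult_ac)
    qed (use K(1) m0 in simp)
  qed
  then have "(\<lambda>k. root k (K * ?m k) / root k K) \<longlonglongrightarrow> L / 1"
    using K(1) by (intro tendsto_divide LIMSEQ_root_const) auto
  moreover have ev: "\<forall>\<^sub>F k in sequentially. root k (K * ?m k) / root k K = root k (?m k)"
    using eventually_gt_at_top[of 0] by eventually_elim (use K(1) in \<open>simp add: real_root_mult\<close>)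
  ultimately have lim: "(\<lambda>k. root k (?m k)) \<longlonglongrightarrow> L"
    by (simp add: tendsto_cong[OF ev])
  have ev': "\<forall>\<^sub>F k in sequentially. root k (?m k)
      = Max ((\<lambda>w. root k (N (word_prod w))) ` {w. set w \<subseteq> \<A> \<and> length w = k})"
    using eventually_gt_at_top[of 0]
    by eventually_elim (simp add: Max_root_eq_root_max_word_norm[OF assms(1,2)])
  have "(\<lambda>k. Max ((\<lambda>w. root k (N (word_prod w))) ` {w. set w \<subseteq> \<A> \<and> length w = k})) \<longlonglongrightarrow> L"
    using lim tendsto_cong[OF ev'] by blast
  then have "joint_spectral_radius N \<A> = L"
    unfolding joint_spectral_radius_def by (rule limI)
  then show ?thesis using lim by simp
qed

text \<open>
  The form in which the spectral radius is used on both sides. From left to right, \<open>\<gamma>\<close> lies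
  strictly between the spectral radius and 1, so that the bound \<open>\<gamma> ^ k\<close> holds for all large
  \<open>k\<close>, and \<open>C\<close> takes care of the finitely many others.
\<close>

lemma joint_spectral_radius_less_1_iff:
  assumes "finite \<A>" "\<A> \<noteq> {}" "matrix_norm N"
  shows "joint_spectral_radius N \<A> < 1 \<longleftrightarrow>
    (\<exists>C \<gamma>. 0 < C \<and> 0 \<le> \<gamma> \<and> \<gamma> < 1 \<and>
      (\<forall>w. set w \<subseteq> \<A> \<longrightarrow> N (word_prod w) \<le> C * \<gamma> ^ length w))" (is "_ \<longleftrightarrow> ?R")
proof
  let ?m = "max_word_norm N \<A>"
  have lim: "(\<lambda>k. root k (?m k)) \<longlonglongrightarrow> joint_spectral_radius N \<A>"
    using joint_spectral_radius_LIMSEQ[OF assms] .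
  have le: "N (word_prod w) \<le> ?m (length w)" if "set w \<subseteq> \<A>" for w
    unfolding max_word_norm_def using finite_words[OF assms(1)] that
    by (intro Max_ge) (auto simp: words_def)
  have m0: "0 \<le> ?m k" for k
  proof -
    obtain w where "w \<in> words \<A> k" using words_nonempty[OF assms(2)] by blast
    then have "N (word_prod w) \<le> ?m k" using le by (auto simp: words_def)
    then show ?thesis using assms(3) by (meson matrix_norm_def order_trans)
  qed
  {
    assume "joint_spectral_radius N \<A> < 1"
    then obtain g where g: "joint_spectral_radius N \<A> < g" "g < 1" using dense by blast
    \<comment> \<open>The maximum with \<open>1/2\<close> makes \<open>\<gamma>\<close> positive, so that one can divide by its powers.\<close>
    define \<gamma> where "\<gamma> = max g (1/2)"
    have \<gamma>: "0 < \<gamma>" "\<gamma> < 1" "joint_spectral_radius N \<A> < \<gamma>" using g by (auto simp: \<gamma>_def)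
    obtain k0 where k0: "\<And>k. k0 \<le> k \<Longrightarrow> root k (?m k) < \<gamma>"
      using order_tendstoD(2)[OF lim \<gamma>(3)] by (auto simp: eventually_sequentially)
    define C where "C = 1 + (\<Sum>k\<le>k0. ?m k / \<gamma> ^ k)"
    have C: "1 \<le> C" unfolding C_def using \<gamma>(1) m0 by (simp add: sum_nonneg)
    have "?m k \<le> C * \<gamma> ^ k" for k
    proof (cases "k \<le> k0")
      case True
      then have "?m k / \<gamma> ^ k \<le> (\<Sum>k\<le>k0. ?m k / \<gamma> ^ k)"
        using \<gamma>(1) m0 by (intro member_le_sum) auto
      then have "?m k / \<gamma> ^ k \<le> C" by (simp add: C_def)
      then show ?thesis using \<gamma>(1) by (simp add: field_simps)
    next
      case False
      then have "0 < k" "root k (?m k) < \<gamma>" using k0 by auto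
      then have "?m k \<le> \<gamma> ^ k"
        by (metis less_imp_le m0 power_mono real_root_ge_zero real_root_pow_pos2)
      also have "\<dots> \<le> C * \<gamma> ^ k" using C \<gamma>(1) by simp
      finally show ?thesis .
    qed
    then have "\<forall>w. set w \<subseteq> \<A> \<longrightarrow> N (word_prod w) \<le> C * \<gamma> ^ length w"
      using le order_trans by blast
    then show ?R using C \<gamma> by (intro exI[of _ C] exI[of _ \<gamma>]) auto
  next
    assume ?R
    then obtain C \<gamma> where C: "0 < C" "0 \<le> \<gamma>" "\<gamma> < 1"
      "\<And>w. set w \<subseteq> \<A> \<Longrightarrow> N (word_prod w) \<le> C * \<gamma> ^ length w" by blast
    have "?m k \<le> C * \<gamma> ^ k" for k
      unfolding max_word_norm_def
      using finite_words[OF assms(1)] words_nonempty[OF assms(2)] C(4)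
      by (intro Max.boundedI) (auto simp: words_def)
    then have "root k (?m k) \<le> root k C * \<gamma>" if "0 < k" for k
      using that C(2) by (metis real_root_le_iff real_root_mult real_root_power_cancel)
    then have "\<forall>\<^sub>F k in sequentially. root k (?m k) \<le> root k C * \<gamma>"
      by (intro eventually_mono[OF eventually_gt_at_top[of 0]])
    moreover have "(\<lambda>k. root k C * \<gamma>) \<longlonglongrightarrow> 1 * \<gamma>"
      by (intro tendsto_intros LIMSEQ_root_const C(1))
    ultimately have "joint_spectral_radius N \<A> \<le> 1 * \<gamma>"
      using lim by (intro tendsto_le[OF _ _ lim]) auto
    then show "joint_spectral_radius N \<A> < 1" using C(3) by simp
  }
qed


section \<open>GE-norms contract only families with decaying products\<close>

text \<open>
  On \<open>K\<close> times a ball the function is uniformly continuous, so near a point all functions of the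
  family, and with them their supremum, change by little.
\<close>

lemma continuous_on_SUP_compact:
  fixes f :: "'a::metric_space \<Rightarrow> 'b::euclidean_space \<Rightarrow> real"
  assumes K: "compact K" "K \<noteq> {}"
    and f: "continuous_on (K \<times> UNIV) (\<lambda>(t, x). f t x)"
  shows "continuous_on UNIV (\<lambda>x. SUP t\<in>K. f t x)"
proof -
  have bdd: "bdd_above ((\<lambda>t. f t x) ` K)" for x
  proof -
    have "continuous_on K (\<lambda>t. (\<lambda>(t, x). f t x) (t, x))"
      by (intro continuous_on_compose2[OF f] continuous_intros) auto
    then show ?thesis
      using K(1) by (auto intro!: bounded_imp_bdd_above compact_imp_bounded compact_continuous_image)
  qed
  have "continuous_on (cball 0 r) (\<lambda>x. SUP t\<in>K. f t x)" for r
  proof -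
    have unif: "uniformly_continuous_on (K \<times> cball 0 r) (\<lambda>(t, x). f t x)"
      by (intro compact_uniformly_continuous continuous_on_subset[OF f] compact_Times K(1)
          compact_cball) auto
    show ?thesis
      unfolding continuous_on_iff
    proof (intro ballI allI impI)
      fix x :: 'b and e :: real
      assume x: "x \<in> cball 0 r" and e: "0 < e"
      then obtain d where d: "0 < d"
        "\<And>p p'. p \<in> K \<times> cball 0 r \<Longrightarrow> p' \<in> K \<times> cball 0 r \<Longrightarrow> dist p' p < d \<Longrightarrow>
          dist ((\<lambda>(t, x). f t x) p') ((\<lambda>(t, x). f t x) p) < e / 2"
        using unif[unfolded uniformly_continuous_on_def, rule_format, of "e / 2"] by fastforce
      have close: "\<bar>f t y - f t z\<bar> < e / 2"
        if "t \<in> K" "y \<in> cball 0 r" "z \<in> cball 0 r" "dist y z < d" for t y z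
        using d(2)[of "(t, z)" "(t, y)"] that by (simp add: dist_Pair_Pair dist_real_def)
      have le: "(SUP t\<in>K. f t y) \<le> (SUP t\<in>K. f t z) + e / 2"
        if "y \<in> cball 0 r" "z \<in> cball 0 r" "dist y z < d" for y z
      proof (rule cSUP_least[OF K(2)])
        fix t assume t: "t \<in> K"
        have "f t y \<le> f t z + e / 2" using close[OF t that] by linarith
        also have "f t z \<le> (SUP t\<in>K. f t z)" by (rule cSUP_upper[OF t bdd])
        finally show "f t y \<le> (SUP t\<in>K. f t z) + e / 2" by simp
      qed
      show "\<exists>d>0. \<forall>y\<in>cball 0 r. dist y x < d \<longrightarrow>
          dist (SUP t\<in>K. f t y) (SUP t\<in>K. f t x) < e"
      proof (intro exI[of _ d] conjI ballI impI d(1))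
        fix y assume "y \<in> cball 0 r" "dist y x < d"
        then show "dist (SUP t\<in>K. f t y) (SUP t\<in>K. f t x) < e"
          using le[of x y] le[of y x] x e by (simp add: dist_real_def dist_commute)
      qed
    qed
  qed
  then have "isCont (\<lambda>x. SUP t\<in>K. f t x) x" for x
    by (rule continuous_on_interior[of "cball 0 (norm x + 1)"]) (simp add: interior_cball)
  then show ?thesis by (simp add: continuous_at_imp_continuous_on)
qed

lemma GE_norm_continuous:
  fixes V :: "real^'n \<Rightarrow> real"
  assumes "GE_norm d V"
  shows "continuous_on UNIV V"
proof -
  obtain P :: "(real poly)^'n^'n"
    where V: "\<And>x. V x = (SUP t\<in>{-1..1}. sqrt (x \<bullet> (eval_mat P t *v x)))"
    using assms unfolding GE_norm_def by blast
  have "continuous_on UNIV (\<lambda>x. SUP t\<in>{-1..1}. sqrt (x \<bullet> (eval_mat P t *v x)))"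
  proof (rule continuous_on_SUP_compact)
    show "continuous_on ({- 1..1} \<times> UNIV) (\<lambda>(t, x). sqrt (x \<bullet> (eval_mat P t *v x)))"
      unfolding split_beta eval_mat_def inner_vec_def matrix_vector_mult_def
      by (auto intro!: continuous_intros)
  qed auto
  then show ?thesis by (simp add: V[abs_def])
qed

lemma bdd_above_GE_norm_values:
  fixes P :: "(real poly)^'n^'n"
  shows "bdd_above ((\<lambda>t. sqrt (x \<bullet> (eval_mat P t *v x))) ` {-1..1})"
proof -
  have "continuous_on {-1..1} (\<lambda>t. sqrt (x \<bullet> (eval_mat P t *v x)))"
    unfolding eval_mat_def inner_vec_def matrix_vector_mult_def
    by (auto intro!: continuous_intros)
  then show ?thesis
    by (auto intro!: bounded_imp_bdd_above compact_imp_bounded compact_continuous_image)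
qed

lemma GE_norm_nonneg:
  fixes V :: "real^'n \<Rightarrow> real"
  assumes "GE_norm d V"
  shows "0 \<le> V x"
proof -
  obtain P :: "(real poly)^'n^'n" where P: "\<And>t. t \<in> {-1..1} \<Longrightarrow> pos_semidef (eval_mat P t)"
    and V: "\<And>x. V x = (SUP t\<in>{-1..1}. sqrt (x \<bullet> (eval_mat P t *v x)))"
    using assms unfolding GE_norm_def by blast
  have "0 \<le> sqrt (x \<bullet> (eval_mat P 0 *v x))"
    using P[of 0] by (simp add: pos_semidef_def)
  also have "\<dots> \<le> V x"
    unfolding V by (intro cSUP_upper bdd_above_GE_norm_values) simp
  finally show ?thesis .
qed

text \<open>
  It suffices to show that \<open>V (c *\<^sub>R x)\<close> is at most \<open>c * V x\<close>: the reverse inequality is the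
  same one for \<open>1 / c\<close> and \<open>c *\<^sub>R x\<close>.
\<close>

lemma GE_norm_homogeneous:
  fixes V :: "real^'n \<Rightarrow> real"
  assumes "GE_norm d V" "0 < c"
  shows "V (c *\<^sub>R x) = c * V x"
proof -
  obtain P :: "(real poly)^'n^'n"
    where V: "\<And>x. V x = (SUP t\<in>{-1..1}. sqrt (x \<bullet> (eval_mat P t *v x)))"
    using assms unfolding GE_norm_def by blast
  have le: "V (c *\<^sub>R x) \<le> c * V x" if c: "0 < c" for c :: real and x
  proof -
    have "sqrt ((c *\<^sub>R x) \<bullet> (eval_mat P t *v (c *\<^sub>R x))) \<le> c * V x" if "t \<in> {-1..1}" for t
    proof -
      have "sqrt ((c *\<^sub>R x) \<bullet> (eval_mat P t *v (c *\<^sub>R x))) = c * sqrt (x \<bullet> (eval_mat P t *v x))"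
        using c by (simp add: matrix_vector_mult_scaleR real_sqrt_mult)
      also have "\<dots> \<le> c * V x"
        unfolding V using c that by (intro mult_left_mono cSUP_upper bdd_above_GE_norm_values) auto
      finally show ?thesis .
    qed
    then show ?thesis unfolding V[of "c *\<^sub>R x"] by (intro cSUP_least) auto
  qed
  have "V x \<le> (1 / c) * V (c *\<^sub>R x)"
    using le[of "1 / c" "c *\<^sub>R x"] assms(2) by simp
  then have "c * V x \<le> V (c *\<^sub>R x)" using assms(2) by (simp add: field_simps)
  then show ?thesis using le[OF assms(2), of x] by simp
qed

text \<open>
  On the compact unit sphere the continuous quotient \<open>V (A *v x) / V x\<close> attains its maximum, which
  is less than 1; \<open>\<gamma>\<close> is the largest of these maxima over \<open>A \<in> \<A>\<close>. Homogeneity extends the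
  contraction by \<open>\<gamma>\<close> to all vectors, and \<open>C\<close> is the ratio of the extreme values of \<open>V\<close> on the
  sphere.
\<close>

lemma contracting_imp_exponential_decay:
  fixes \<A> :: "(real^'n^'n) set" and V :: "real^'n \<Rightarrow> real"
  assumes "finite \<A>" "\<A> \<noteq> {}" and contr: "contracting \<A> V"
    and cont: "continuous_on UNIV V" and nonneg: "\<And>x. 0 \<le> V x"
    and homogeneous: "\<And>c x. 0 < c \<Longrightarrow> V (c *\<^sub>R x) = c * V x"
  obtains C \<gamma> where "0 < C" "0 \<le> \<gamma>" "\<gamma> < 1"
    "\<And>w x. set w \<subseteq> \<A> \<Longrightarrow> norm (word_prod w *v x) \<le> C * \<gamma> ^ length w * norm x"
proof -
  obtain A0 where A0: "A0 \<in> \<A>" using assms(2) by blast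
  \<comment> \<open>Strict contraction makes \<open>V x\<close> exceed a nonnegative number.\<close>
  have pos: "0 < V x" if "x \<noteq> 0" for x
    using contr A0 that nonneg[of "A0 *v x"] unfolding contracting_def by fastforce
  have V0: "V 0 = 0" using homogeneous[of 2 0] by simp
  have polar: "\<exists>u \<in> sphere 0 1. x = norm x *\<^sub>R u \<and> 0 < norm x" if "x \<noteq> 0" for x :: "real^'n"
    using that by (intro bexI[of _ "(1 / norm x) *\<^sub>R x"]) auto
  have contS: "continuous_on (sphere 0 1) V" using cont continuous_on_subset by blast
  obtain b :: "real^'n" where "b \<in> Basis" using nonempty_Basis by blast
  then have ne: "sphere (0::real^'n) 1 \<noteq> {}" by (metis empty_iff mem_sphere_0 norm_Basis)
  obtain u where u: "u \<in> sphere 0 1" "\<And>x. x \<in> sphere 0 1 \<Longrightarrow> V u \<le> V x"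
    using continuous_attains_inf[OF compact_sphere ne contS] by blast
  obtain v where v: "v \<in> sphere 0 1" "\<And>x. x \<in> sphere 0 1 \<Longrightarrow> V x \<le> V v"
    using continuous_attains_sup[OF compact_sphere ne contS] by blast
  have lower: "V u * norm x \<le> V x" and upper: "V x \<le> V v * norm x" for x
  proof -
    have "V u * norm x \<le> V x \<and> V x \<le> V v * norm x"
    proof (cases "x = 0")
      case False
      then obtain y where "y \<in> sphere 0 1" "x = norm x *\<^sub>R y" "0 < norm x" using polar by blast
      then show ?thesis using u(2) v(2) homogeneous by (metis mult.commute mult_left_mono less_imp_le)
    qed (simp add: V0)
    then show "V u * norm x \<le> V x" "V x \<le> V v * norm x" by auto
  qed
  have uv: "0 < V u" "0 < V v" using u(1) v(1) by (auto intro!: pos)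
  have "\<exists>g. 0 \<le> g \<and> g < 1 \<and> (\<forall>x. V (A *v x) \<le> g * V x)" if A: "A \<in> \<A>" for A
  proof -
    have "continuous_on (sphere 0 1) (\<lambda>x. V (A *v x) / V x)"
    proof (intro continuous_on_divide contS ballI)
      show "continuous_on (sphere 0 1) (\<lambda>x. V (A *v x))"
        by (rule continuous_on_compose2[OF cont])
          (auto intro: linear_continuous_on simp flip: linear_conv_bounded_linear)
      show "V x \<noteq> 0" if "x \<in> sphere 0 1" for x using that pos[of x] by force
    qed
    then obtain z where z: "z \<in> sphere 0 1"
      "\<And>x. x \<in> sphere 0 1 \<Longrightarrow> V (A *v x) / V x \<le> V (A *v z) / V z"
      using continuous_attains_sup[OF compact_sphere ne] by blast
    have "z \<noteq> 0" using z(1) by auto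
    then have "V (A *v z) < V z" using contr A unfolding contracting_def by blast
    then have "V (A *v z) / V z < 1" using pos[OF \<open>z \<noteq> 0\<close>] by simp
    moreover have "V (A *v x) \<le> V (A *v z) / V z * V x" for x
    proof (cases "x = 0")
      case False
      then obtain y where y: "y \<in> sphere 0 1" "x = norm x *\<^sub>R y" "0 < norm x" using polar by blast
      then have "0 < V y" by (intro pos) auto
      then have "V (A *v y) \<le> V (A *v z) / V z * V y"
        using z(2)[OF y(1)] by (simp add: pos_divide_le_eq)
      then have "norm x * V (A *v y) \<le> norm x * (V (A *v z) / V z * V y)"
        using y(3) by (intro mult_left_mono) auto
      then show ?thesis
        using homogeneous[OF y(3), of y] homogeneous[OF y(3), of "A *v y"] y(2)
        by (metis matrix_vector_mult_scaleR mult.left_commute)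
    qed (simp add: V0)
    ultimately show ?thesis using nonneg by (intro exI[of _ "V (A *v z) / V z"]) auto
  qed
  then obtain g where g: "\<And>A. A \<in> \<A> \<Longrightarrow> 0 \<le> g A \<and> g A < 1"
    "\<And>A x. A \<in> \<A> \<Longrightarrow> V (A *v x) \<le> g A * V x" by metis
  define \<gamma> where "\<gamma> = Max (g ` \<A>)"
  have \<gamma>: "\<gamma> < 1" "\<And>A. A \<in> \<A> \<Longrightarrow> g A \<le> \<gamma>"
    unfolding \<gamma>_def using assms(1,2) g(1) by auto
  have \<gamma>0: "0 \<le> \<gamma>" using g(1)[OF A0] \<gamma>(2)[OF A0] by linarith
  have decay: "V (word_prod w *v x) \<le> \<gamma> ^ length w * V x" if "set w \<subseteq> \<A>" for w x
    using that
  proof (induction w rule: rev_induct)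
    case (snoc A w)
    then have A: "A \<in> \<A>" by simp
    have "V (word_prod (w @ [A]) *v x) \<le> g A * V (word_prod w *v x)"
      using g(2)[OF A, of "word_prod w *v x"] by (simp add: matrix_vector_mul_assoc)
    also have "\<dots> \<le> \<gamma> * (\<gamma> ^ length w * V x)"
      using snoc \<gamma>(2)[OF A] \<gamma>0 nonneg by (intro mult_mono) auto
    finally show ?case by (simp add: mult.assoc)
  qed simp
  have "norm (word_prod w *v x) \<le> V v / V u * \<gamma> ^ length w * norm x" if "set w \<subseteq> \<A>" for w x
  proof -
    have "V u * norm (word_prod w *v x) \<le> \<gamma> ^ length w * V x"
      using lower decay[OF that] order_trans by blast
    also have "\<dots> \<le> \<gamma> ^ length w * (V v * norm x)"
      using upper \<gamma>0 by (intro mult_left_mono) auto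
    finally show ?thesis using uv by (simp add: field_simps)
  qed
  then show ?thesis using that[of "V v / V u" \<gamma>] uv \<gamma>0 \<gamma>(1) by simp
qed

text \<open>
  The norm of a matrix type is the Euclidean norm of the entries, so it is at most the sum of their
  absolute values, and each entry is a coordinate of the image of a unit vector.
\<close>

lemma norm_le_operator_bound:
  fixes M :: "real^'n^'m"
  assumes "\<And>x. norm (M *v x) \<le> b * norm x"
  shows "norm M \<le> real CARD('m) * real CARD('n) * b"
proof -
  have entry: "\<bar>M $ i $ j\<bar> \<le> b" for i j
  proof -
    have "M $ i $ j = (M *v axis j 1) $ i"
      by (simp add: matrix_vector_mul_component inner_axis)
    also have "\<bar>\<dots>\<bar> \<le> norm (M *v axis j 1)" by (rule component_le_norm_cart)
    also have "\<dots> \<le> b" using assms[of "axis j 1"] by simp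
    finally show ?thesis .
  qed
  have "norm M \<le> (\<Sum>i\<in>UNIV. norm (M $ i))"
    unfolding norm_vec_def[of M] by (intro L2_set_le_sum) auto
  also have "\<dots> \<le> (\<Sum>i\<in>(UNIV::'m set). \<Sum>j\<in>(UNIV::'n set). b)"
    by (intro sum_mono order_trans[OF norm_le_l1_cart] entry)
  finally show ?thesis by simp
qed

lemma contracting_GE_norm_imp_joint_spectral_radius_less_1:
  fixes \<A> :: "(real^'n^'n) set"
  assumes "finite \<A>" "\<A> \<noteq> {}" "matrix_norm N" "GE_norm d V" "contracting \<A> V"
  shows "joint_spectral_radius N \<A> < 1"
proof -
  obtain C \<gamma> where C: "0 < C" "0 \<le> \<gamma>" "\<gamma> < 1"
    "\<And>w x. set w \<subseteq> \<A> \<Longrightarrow> norm (word_prod w *v x) \<le> C * \<gamma> ^ length w * norm x"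
    using contracting_imp_exponential_decay[OF assms(1,2,5) GE_norm_continuous[OF assms(4)]
        GE_norm_nonneg[OF assms(4)] GE_norm_homogeneous[OF assms(4)]] by blast
  obtain c' C' where C': "0 < c'" "0 < C'"
    "\<And>M. c' * norm M \<le> N M" "\<And>M. N M \<le> C' * norm M"
    using matrix_norm_equivalent_to_euclidean[OF assms(3)] by blast
  define D where "D = C' * (real CARD('n) * real CARD('n) * C)"
  have "N (word_prod w) \<le> D * \<gamma> ^ length w" if "set w \<subseteq> \<A>" for w
  proof -
    have "N (word_prod w) \<le> C' * norm (word_prod w)" by (rule C'(4))
    also have "\<dots> \<le> C' * (real CARD('n) * real CARD('n) * (C * \<gamma> ^ length w))"
      using C'(2) norm_le_operator_bound[OF C(4)[OF that]] by (intro mult_left_mono) auto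
    finally show ?thesis by (simp add: D_def mult.assoc)
  qed
  moreover have "0 < D" unfolding D_def using C(1) C'(2) by simp
  ultimately show ?thesis
    using joint_spectral_radius_less_1_iff[OF assms(1-3)] C(2,3) by blast
qed


section \<open>Approximating a maximum of quadratic forms by a polynomial matrix\<close>

text \<open>
  Take \<open>p\<^sub>i(t) = (1 - (t - \<tau>\<^sub>i)\<^sup>2 / 4) ^ m\<close> with equidistant nodes \<open>\<tau>\<^sub>i\<close>. On \<open>[-1, 1]\<close> the base
  lies in \<open>[0, 1]\<close>. For nodes with mutual distance at least \<open>1 / n\<close>, every \<open>t\<close> is closer than
  \<open>1 / (2 * n)\<close> to at most one of them; the polynomials of all other nodes are uniformly small at
  \<open>t\<close> when the exponent \<open>m\<close> is large.
\<close>

lemma peaked_polynomials: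
  fixes I :: "'i set" and \<epsilon> :: real
  assumes "finite I" "I \<noteq> {}" "0 < \<epsilon>"
  obtains p :: "'i \<Rightarrow> real poly" and \<tau> :: "'i \<Rightarrow> real"
  where "\<And>i. i \<in> I \<Longrightarrow> \<tau> i \<in> {-1..1}" "\<And>i. i \<in> I \<Longrightarrow> poly (p i) (\<tau> i) = 1"
    "\<And>i t. t \<in> {-1..1} \<Longrightarrow> i \<in> I \<Longrightarrow> 0 \<le> poly (p i) t"
    "\<And>t. t \<in> {-1..1} \<Longrightarrow> (\<Sum>i\<in>I. poly (p i) t) \<le> 1 + \<epsilon>"
proof -
  define n where "n = real (card I)"
  have n: "1 \<le> n"
    unfolding n_def using assms(1,2) by (simp add: Suc_leI card_gt_0_iff)
  obtain h where h: "bij_betw h I {0..<card I}"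
    using ex_bij_betw_finite_nat[OF assms(1)] by blast
  define \<tau> where "\<tau> i = real (h i) / n" for i
  have \<tau>: "0 \<le> \<tau> i \<and> \<tau> i \<le> 1" if "i \<in> I" for i
  proof -
    have "h i < card I" using h that bij_betwE by fastforce
    then show ?thesis using n by (simp add: \<tau>_def n_def)
  qed
  have sep: "1 / n \<le> \<bar>\<tau> i - \<tau> j\<bar>" if "i \<in> I" "j \<in> I" "i \<noteq> j" for i j
  proof -
    have "h i \<noteq> h j" using h that by (metis bij_betw_imp_inj_on inj_onD)
    then have "1 \<le> \<bar>real (h i) - real (h j)\<bar>" by linarith
    moreover have "\<tau> i - \<tau> j = (real (h i) - real (h j)) / n"
      by (simp add: \<tau>_def diff_divide_distrib)
    ultimately show ?thesis using n by (simp add: abs_divide divide_right_mono)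
  qed
  \<comment> \<open>The bound for the base at distance at least \<open>1 / (2 * n)\<close> from the node.\<close>
  define q where "q = 1 - (1 / 4) * (1 / (2 * n))\<^sup>2"
  have "(1 / (2 * n))\<^sup>2 \<le> 1" using n by (intro power_le_one) auto
  moreover have "0 < (1 / (2 * n))\<^sup>2" using n by simp
  ultimately have q: "0 \<le> q" "q < 1" unfolding q_def by linarith+
  obtain m where m: "q ^ m < \<epsilon> / n"
    using real_arch_pow_inv[OF _ q(2), of "\<epsilon> / n"] assms(3) n by auto
  define p where "p i = ([:1:] - smult (1 / 4) ([:- \<tau> i, 1:]\<^sup>2)) ^ m" for i
  have p: "poly (p i) t = (1 - (1 / 4) * (t - \<tau> i)\<^sup>2) ^ m" for i t
    by (simp add: p_def)
  have base: "0 \<le> 1 - (1 / 4) * (t - \<tau> i)\<^sup>2" if "t \<in> {-1..1}" "i \<in> I" for i t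
  proof -
    have "\<bar>t - \<tau> i\<bar> \<le> 2" using that \<tau>[of i] by auto
    then have "(t - \<tau> i)\<^sup>2 \<le> 2\<^sup>2" by (metis abs_le_square_iff abs_numeral)
    then show ?thesis by simp
  qed
  have far: "poly (p i) t \<le> \<epsilon> / n" if "t \<in> {-1..1}" "i \<in> I" "1 / (2 * n) \<le> \<bar>t - \<tau> i\<bar>" for i t
  proof -
    have "(1 / (2 * n))\<^sup>2 \<le> \<bar>t - \<tau> i\<bar>\<^sup>2" using n that(3) by (intro power_mono) auto
    then have "1 - (1 / 4) * (t - \<tau> i)\<^sup>2 \<le> q" by (simp add: q_def)
    then have "poly (p i) t \<le> q ^ m" unfolding p using base[OF that(1,2)] by (intro power_mono) auto
    then show ?thesis using m by simp
  qed
  have near: "poly (p i) t \<le> 1" if "t \<in> {-1..1}" "i \<in> I" for i t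
    unfolding p using base[OF that] by (intro power_le_one) auto
  have "(\<Sum>i\<in>I. poly (p i) t) \<le> 1 + \<epsilon>" if t: "t \<in> {-1..1}" for t
  proof -
    have "\<exists>k. \<forall>i\<in>I. poly (p i) t \<le> \<epsilon> / n + (if i = k then 1 else 0)"
    proof (cases "\<exists>k\<in>I. \<bar>t - \<tau> k\<bar> < 1 / (2 * n)")
      case True
      then obtain k where k: "k \<in> I" "\<bar>t - \<tau> k\<bar> < 1 / (2 * n)" by blast
      have "poly (p i) t \<le> \<epsilon> / n + (if i = k then 1 else 0)" if "i \<in> I" for i
      proof (cases "i = k")
        case True
        have "0 \<le> \<epsilon> / n" using assms(3) n by simp
        then show ?thesis using near[OF t that] True by simp
      next
        case False
        have "1 / n = 1 / (2 * n) + 1 / (2 * n)" by simp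
        then have "1 / (2 * n) \<le> \<bar>t - \<tau> i\<bar>" using k sep[OF that k(1) False] by linarith
        then show ?thesis using far[OF t that] False by simp
      qed
      then show ?thesis by blast
    next
      case False
      have "poly (p i) t \<le> \<epsilon> / n + (if i = k then 1 else 0)" if "i \<in> I" for i k
        using far[OF t that] False that by (auto simp: not_less intro: order_trans)
      then show ?thesis by blast
    qed
    then obtain k where "\<And>i. i \<in> I \<Longrightarrow> poly (p i) t \<le> \<epsilon> / n + (if i = k then 1 else 0)" by blast
    then have "(\<Sum>i\<in>I. poly (p i) t) \<le> (\<Sum>i\<in>I. \<epsilon> / n + (if i = k then 1 else 0))"
      by (rule sum_mono)
    also have "\<dots> = n * (\<epsilon> / n) + (if k \<in> I then 1 else 0)"
      using assms(1) by (simp add: sum.distrib n_def)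
    also have "\<dots> \<le> 1 + \<epsilon>" using n by simp
    finally show ?thesis .
  qed
  moreover have "0 \<le> poly (p i) t" if "t \<in> {-1..1}" "i \<in> I" for i t
    unfolding p using base[OF that] by simp
  moreover have "poly (p i) (\<tau> i) = 1" for i by (simp add: p)
  moreover have "\<tau> i \<in> {-1..1}" if "i \<in> I" for i using \<tau>[OF that] by simp
  ultimately show ?thesis using that by blast
qed

lemma inner_sum_scaleR_matrix_vector:
  fixes Q :: "'i \<Rightarrow> real^'n^'n"
  shows "x \<bullet> ((\<Sum>i\<in>I. c i *\<^sub>R Q i) *v x) = (\<Sum>i\<in>I. c i * (x \<bullet> (Q i *v x)))"
proof -
  have "linear (\<lambda>M::real^'n^'n. M *v x)"
    using bilinear_matrix_vector_mult unfolding bilinear_def by blast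
  then have "(\<Sum>i\<in>I. c i *\<^sub>R Q i) *v x = (\<Sum>i\<in>I. c i *\<^sub>R (Q i *v x))"
    by (simp add: linear_sum[of "\<lambda>M. M *v x"] scaleR_matrix_vector_assoc)
  then show ?thesis by (simp add: inner_sum_right)
qed

text \<open>
  The quadratic form of \<open>P(t) = (\<Sum>i. p\<^sub>i(t) Q\<^sub>i)\<close> is a nonnegative combination of those of the
  \<open>Q\<^sub>i\<close>. Its weights have sum at most \<open>1 + \<epsilon>\<close>, and at the node of \<open>i\<close> the weight of \<open>Q\<^sub>i\<close>
  is 1. Bounding by an arbitrary \<open>b\<close> stands for bounding by the maximum of the forms at \<open>x\<close>.
\<close>

lemma polynomial_matrix_envelope:
  fixes Q :: "'i \<Rightarrow> real^'n^'n"
  assumes "finite I" "I \<noteq> {}" "0 < \<epsilon>" and psd: "\<And>i. i \<in> I \<Longrightarrow> pos_semidef (Q i)"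
  obtains P :: "(real poly)^'n^'n" where "transpose P = P"
    "\<And>t. t \<in> {-1..1} \<Longrightarrow> pos_semidef (eval_mat P t)"
    "\<And>i. i \<in> I \<Longrightarrow> \<exists>t\<in>{-1..1}. \<forall>x. x \<bullet> (Q i *v x) \<le> x \<bullet> (eval_mat P t *v x)"
    "\<And>t x b. t \<in> {-1..1} \<Longrightarrow> \<forall>i\<in>I. x \<bullet> (Q i *v x) \<le> b \<Longrightarrow>
      x \<bullet> (eval_mat P t *v x) \<le> (1 + \<epsilon>) * b"
proof -
  obtain p :: "'i \<Rightarrow> real poly" and \<tau> :: "'i \<Rightarrow> real"
    where \<tau>: "\<And>i. i \<in> I \<Longrightarrow> \<tau> i \<in> {-1..1}" "\<And>i. i \<in> I \<Longrightarrow> poly (p i) (\<tau> i) = 1"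
    and p0: "\<And>i t. t \<in> {-1..1} \<Longrightarrow> i \<in> I \<Longrightarrow> 0 \<le> poly (p i) t"
    and p1: "\<And>t. t \<in> {-1..1} \<Longrightarrow> (\<Sum>i\<in>I. poly (p i) t) \<le> 1 + \<epsilon>"
    by (rule peaked_polynomials[OF assms(1-3), OF that])
  have Q0: "0 \<le> x \<bullet> (Q i *v x)" if "i \<in> I" for i x
    using psd[OF that] by (simp add: pos_semidef_def)
  have Qsym: "Q i $ k $ j = Q i $ j $ k" if "i \<in> I" for i j k
  proof -
    have "transpose (Q i) $ j $ k = Q i $ j $ k" using psd[OF that] by (simp add: pos_semidef_def)
    then show ?thesis by (simp add: transpose_def)
  qed
  define P :: "(real poly)^'n^'n" where "P = (\<chi> j k. \<Sum>i\<in>I. smult (Q i $ j $ k) (p i))"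
  have Pt: "eval_mat P t = (\<Sum>i\<in>I. poly (p i) t *\<^sub>R Q i)" for t
    by (simp add: eval_mat_def P_def vec_eq_iff poly_sum mult.commute)
  have quad: "x \<bullet> (eval_mat P t *v x) = (\<Sum>i\<in>I. poly (p i) t * (x \<bullet> (Q i *v x)))" for t x
    unfolding Pt by (rule inner_sum_scaleR_matrix_vector)
  have sym: "transpose P = P"
    using Qsym by (simp add: P_def transpose_def vec_eq_iff)
  show ?thesis
  proof (rule that[OF sym])
    show "pos_semidef (eval_mat P t)" if t: "t \<in> {-1..1}" for t
      unfolding pos_semidef_def
    proof
      show "transpose (eval_mat P t) = eval_mat P t"
        using sym by (simp add: eval_mat_def transpose_def vec_eq_iff)
      show "\<forall>x. 0 \<le> x \<bullet> (eval_mat P t *v x)"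
        unfolding quad using t p0 Q0 by (auto intro!: sum_nonneg)
    qed
    show "\<exists>t\<in>{-1..1}. \<forall>x. x \<bullet> (Q i *v x) \<le> x \<bullet> (eval_mat P t *v x)" if i: "i \<in> I" for i
    proof (intro bexI allI)
      fix x
      have "poly (p i) (\<tau> i) * (x \<bullet> (Q i *v x)) \<le> x \<bullet> (eval_mat P (\<tau> i) *v x)"
        unfolding quad using i \<tau>(1) p0 Q0 assms(1)
        by (intro member_le_sum[of i I "\<lambda>j. poly (p j) (\<tau> i) * (x \<bullet> (Q j *v x))"]) auto
      then show "x \<bullet> (Q i *v x) \<le> x \<bullet> (eval_mat P (\<tau> i) *v x)" using \<tau>(2)[OF i] by simp
    qed (rule \<tau>(1)[OF i])
    show "x \<bullet> (eval_mat P t *v x) \<le> (1 + \<epsilon>) * b"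
      if t: "t \<in> {-1..1}" and "\<forall>i\<in>I. x \<bullet> (Q i *v x) \<le> b" for t x b
    proof -
      have b: "x \<bullet> (Q i *v x) \<le> b" if "i \<in> I" for i using \<open>\<forall>i\<in>I. _ \<le> b\<close> that by blast
      have "0 \<le> b" using assms(2) b Q0 order_trans by blast
      have "x \<bullet> (eval_mat P t *v x) \<le> (\<Sum>i\<in>I. poly (p i) t * b)"
        unfolding quad using t b p0 by (intro sum_mono mult_left_mono) auto
      also have "\<dots> = (\<Sum>i\<in>I. poly (p i) t) * b" by (simp add: sum_distrib_right)
      also have "\<dots> \<le> (1 + \<epsilon>) * b" using p1[OF t] \<open>0 \<le> b\<close> by (rule mult_right_mono)
      finally show ?thesis .
    qed
  qed
qed

lemma pos_semidef_gram:
  fixes A :: "real^'n^'n"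
  assumes "0 \<le> c"
  shows "pos_semidef (c *\<^sub>R (transpose A ** A))"
    and "x \<bullet> ((c *\<^sub>R (transpose A ** A)) *v x) = c * (norm (A *v x))\<^sup>2"
proof -
  have quad: "x \<bullet> ((c *\<^sub>R (transpose A ** A)) *v x) = c * (norm (A *v x))\<^sup>2" for x
  proof -
    have "x \<bullet> ((transpose A ** A) *v x) = (A *v x) \<bullet> (A *v x)"
      by (metis dot_lmul_matrix matrix_vector_mul_assoc vector_transpose_matrix transpose_transpose)
    then show ?thesis by (simp add: power2_norm_eq_inner flip: scaleR_matrix_vector_assoc)
  qed
  show "x \<bullet> ((c *\<^sub>R (transpose A ** A)) *v x) = c * (norm (A *v x))\<^sup>2" by (rule quad)
  show "pos_semidef (c *\<^sub>R (transpose A ** A))"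
    unfolding pos_semidef_def quad using assms
    by (simp add: transpose_scalar matrix_transpose_mul)
qed

section \<open>Decaying products admit a contracting GE-norm\<close>

text \<open>
  For \<open>A \<in> \<A>\<close>, the form of the word \<open>w\<close> at \<open>A *v x\<close> is \<open>1 / s\<close> times the form of the word
  \<open>A # w\<close> at \<open>x\<close>. Either \<open>A # w\<close> still belongs to \<open>I\<close>, or it has the first excluded length
  \<open>m + 1\<close>; the choice of \<open>s\<close> and \<open>m\<close> makes the decay of such long products outweigh the factor
  \<open>s ^ (m + 1)\<close>, so that its form is at most \<open>(norm x)\<^sup>2\<close>, the form of the empty word.
\<close>

lemma exponential_decay_imp_max_of_quadratics:
  fixes \<A> :: "(real^'n^'n) set"
  assumes "finite \<A>" "0 < C" "0 \<le> \<gamma>" "\<gamma> < 1"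
    and decay: "\<And>w x. set w \<subseteq> \<A> \<Longrightarrow> norm (word_prod w *v x) \<le> C * \<gamma> ^ length w * norm x"
  obtains s :: real and I where "1 < s" "finite I" "[] \<in> I"
    "\<And>A w x b. A \<in> \<A> \<Longrightarrow> w \<in> I \<Longrightarrow>
      \<forall>v\<in>I. s ^ length v * (norm (word_prod v *v x))\<^sup>2 \<le> b \<Longrightarrow>
      s ^ length w * (norm (word_prod w *v (A *v x)))\<^sup>2 \<le> b / s"
proof -
  have \<gamma>2: "\<gamma>\<^sup>2 < 1" using assms(3,4) by (simp add: power_less_one_iff)
  \<comment> \<open>Any \<open>s > 1\<close> with \<open>s * \<gamma>\<^sup>2 < 1\<close> would do.\<close>
  define s where "s = 2 / (1 + \<gamma>\<^sup>2)"
  have \<gamma>2': "0 < 1 + \<gamma>\<^sup>2" by (simp add: add_pos_nonneg)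
  have s: "1 < s" using \<gamma>2 \<gamma>2' by (simp add: s_def)
  have s\<gamma>: "s * \<gamma>\<^sup>2 < 1" "0 \<le> s * \<gamma>\<^sup>2" using \<gamma>2 \<gamma>2' by (simp_all add: s_def)
  obtain m where m: "(s * \<gamma>\<^sup>2) ^ m < 1 / C\<^sup>2"
    using real_arch_pow_inv[OF _ s\<gamma>(1), of "1 / C\<^sup>2"] assms(2) by auto
  define I where "I = {w. set w \<subseteq> \<A> \<and> length w \<le> m}"
  show ?thesis
  proof (rule that[OF s])
    show "finite I" unfolding I_def by (rule finite_lists_length_le[OF assms(1)])
    show "[] \<in> I" by (simp add: I_def)
    fix A w x b
    assume A: "A \<in> \<A>" and w: "w \<in> I"
      and "\<forall>v\<in>I. s ^ length v * (norm (word_prod v *v x))\<^sup>2 \<le> b"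
    then have b: "s ^ length v * (norm (word_prod v *v x))\<^sup>2 \<le> b" if "v \<in> I" for v
      using that by blast
    have "s ^ length (A # w) * (norm (word_prod (A # w) *v x))\<^sup>2 \<le> b"
    proof (cases "length w < m")
      case True
      then show ?thesis using A w by (intro b) (auto simp: I_def)
    next
      case False
      then have len: "length (A # w) = Suc m" and sub: "set (A # w) \<subseteq> \<A>"
        using A w by (auto simp: I_def)
      have "(norm (word_prod (A # w) *v x))\<^sup>2 \<le> (C * \<gamma> ^ Suc m * norm x)\<^sup>2"
        using decay[OF sub, of x] len by (intro power_mono) auto
      then have "s ^ Suc m * (norm (word_prod (A # w) *v x))\<^sup>2
          \<le> s ^ Suc m * (C * \<gamma> ^ Suc m * norm x)\<^sup>2"
        using s by (intro mult_left_mono) auto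
      also have "\<dots> = (C\<^sup>2 * (s * \<gamma>\<^sup>2) ^ Suc m) * (norm x)\<^sup>2"
        by (simp add: power_mult_distrib power_mult[symmetric] mult.commute[of 2] mult_ac)
      also have "\<dots> \<le> 1 * (norm x)\<^sup>2"
      proof (rule mult_right_mono)
        have "(s * \<gamma>\<^sup>2) ^ Suc m \<le> (s * \<gamma>\<^sup>2) ^ m"
          using s\<gamma> by (intro power_decreasing) auto
        then have "(s * \<gamma>\<^sup>2) ^ Suc m \<le> 1 / C\<^sup>2" using m by linarith
        then show "C\<^sup>2 * (s * \<gamma>\<^sup>2) ^ Suc m \<le> 1" using assms(2) by (simp add: field_simps)
      qed simp
      also have "\<dots> \<le> b" using b[OF \<open>[] \<in> I\<close>] by simp
      finally show ?thesis by (simp only: len)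
    qed
    then have "s * (s ^ length w * (norm (word_prod w *v (A *v x)))\<^sup>2) \<le> b"
      by (simp add: word_prod_Cons mult.assoc flip: matrix_vector_mul_assoc)
    then show "s ^ length w * (norm (word_prod w *v (A *v x)))\<^sup>2 \<le> b / s"
      using s by (simp add: field_simps)
  qed
qed

text \<open>
  The forms of \<open>exponential_decay_imp_max_of_quadratics\<close> contract by the factor \<open>1 / s\<close>, and
  passing to \<open>P\<close> loses the factor \<open>1 + \<epsilon> < s\<close>. The empty word contributes \<open>(norm x)\<^sup>2\<close>,
  which makes the common kernel trivial.
\<close>

lemma exponential_decay_imp_contracting_GE_norm:
  fixes \<A> :: "(real^'n^'n) set"
  assumes "finite \<A>" "0 < C" "0 \<le> \<gamma>" "\<gamma> < 1"
    and decay: "\<And>w x. set w \<subseteq> \<A> \<Longrightarrow> norm (word_prod w *v x) \<le> C * \<gamma> ^ length w * norm x"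
  shows "\<exists>d (V :: real^'n \<Rightarrow> real). GE_norm d V \<and> contracting \<A> V"
proof -
  obtain s :: real and I where s: "1 < s" and I: "finite I" "[] \<in> I"
    and step: "\<And>A w x b. A \<in> \<A> \<Longrightarrow> w \<in> I \<Longrightarrow>
      \<forall>v\<in>I. s ^ length v * (norm (word_prod v *v x))\<^sup>2 \<le> b \<Longrightarrow>
      s ^ length w * (norm (word_prod w *v (A *v x)))\<^sup>2 \<le> b / s"
    using exponential_decay_imp_max_of_quadratics[OF assms] by metis
  define \<epsilon> where "\<epsilon> = (s - 1) / 2"
  have \<epsilon>: "0 < \<epsilon>" "1 + \<epsilon> < s" using s by (auto simp: \<epsilon>_def field_simps)
  define Q where "Q w = s ^ length w *\<^sub>R (transpose (word_prod w) ** word_prod w)"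
    for w :: "(real^'n^'n) list"
  have psd: "pos_semidef (Q w)" for w
    unfolding Q_def using s by (intro pos_semidef_gram(1)) simp
  have Q: "x \<bullet> (Q w *v x) = s ^ length w * (norm (word_prod w *v x))\<^sup>2" for w x
    unfolding Q_def using s by (intro pos_semidef_gram(2)) simp
  obtain P :: "(real poly)^'n^'n" where sym: "transpose P = P"
    and psdP: "\<And>t. t \<in> {-1..1} \<Longrightarrow> pos_semidef (eval_mat P t)"
    and above: "\<And>w. w \<in> I \<Longrightarrow>
      \<exists>t\<in>{-1..1}. \<forall>x. x \<bullet> (Q w *v x) \<le> x \<bullet> (eval_mat P t *v x)"
    and below: "\<And>t x b. t \<in> {-1..1} \<Longrightarrow> \<forall>w\<in>I. x \<bullet> (Q w *v x) \<le> b \<Longrightarrow>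
      x \<bullet> (eval_mat P t *v x) \<le> (1 + \<epsilon>) * b"
    using polynomial_matrix_envelope[of I \<epsilon> Q, OF I(1) _ \<epsilon>(1) psd] I(2) by blast
  define V where "V x = (SUP t\<in>{-1..1}. sqrt (x \<bullet> (eval_mat P t *v x)))" for x :: "real^'n"
  have "(\<Inter>t\<in>{-1..1}. mat_kernel (eval_mat P t)) = {0}"
  proof (intro equalityI subsetI)
    fix x assume x: "x \<in> (\<Inter>t\<in>{-1..1}. mat_kernel (eval_mat P t))"
    obtain t where "t \<in> {-1..1}" "x \<bullet> (Q [] *v x) \<le> x \<bullet> (eval_mat P t *v x)"
      using above[OF I(2)] by blast
    then have "(norm x)\<^sup>2 \<le> 0" using x by (simp add: Q mat_kernel_def)
    then show "x \<in> {0}" by simp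
  qed (simp add: mat_kernel_def)
  then have "GE_norm (mat_degree P) V"
    unfolding GE_norm_def using sym psdP V_def by blast
  moreover have "contracting \<A> V"
    unfolding contracting_def
  proof (intro ballI allI impI)
    fix A and x :: "real^'n"
    assume A: "A \<in> \<A>" and x: "x \<noteq> 0"
    define b where "b = Max ((\<lambda>w. x \<bullet> (Q w *v x)) ` I)"
    have b: "x \<bullet> (Q w *v x) \<le> b" if "w \<in> I" for w
      unfolding b_def using I(1) that by (intro Max_ge) auto
    have b0: "0 < b"
    proof -
      have "0 < (norm x)\<^sup>2" using x by simp
      also have "(norm x)\<^sup>2 \<le> b" using b[OF I(2)] by (simp add: Q)
      finally show ?thesis .
    qed
    have "(A *v x) \<bullet> (eval_mat P t *v (A *v x)) \<le> (1 + \<epsilon>) * (b / s)" if "t \<in> {-1..1}" for t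
    proof (rule below[OF that], rule ballI)
      fix w assume w: "w \<in> I"
      show "(A *v x) \<bullet> (Q w *v (A *v x)) \<le> b / s"
        unfolding Q using b by (intro step[OF A w]) (simp add: Q)
    qed
    then have "V (A *v x) \<le> sqrt ((1 + \<epsilon>) * (b / s))"
      unfolding V_def by (intro cSUP_least) auto
    also have "\<dots> < sqrt b"
    proof -
      have "(1 + \<epsilon>) * b < s * b" using \<epsilon>(2) b0 by (rule mult_strict_right_mono)
      then show ?thesis using s by (simp add: divide_less_eq mult.commute)
    qed
    also have "\<dots> \<le> V x"
    proof -
      have "b \<in> (\<lambda>w. x \<bullet> (Q w *v x)) ` I"
        unfolding b_def using I by (intro Max_in) auto
      then obtain w where w: "w \<in> I" "b = x \<bullet> (Q w *v x)" by blast
      obtain t where t: "t \<in> {-1..1}" "x \<bullet> (Q w *v x) \<le> x \<bullet> (eval_mat P t *v x)"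
        using above[OF w(1)] by blast
      have "sqrt b \<le> sqrt (x \<bullet> (eval_mat P t *v x))" using t(2) w(2) by simp
      also have "\<dots> \<le> V x"
        unfolding V_def using t(1) by (intro cSUP_upper bdd_above_GE_norm_values)
      finally show ?thesis .
    qed
    finally show "V (A *v x) < V x" .
  qed
  ultimately show ?thesis by blast
qed

theorem theorem6p2:
  fixes \<A> :: "(real^'n^'n) set"
    and N :: "real^'n^'n \<Rightarrow> real"
  assumes "finite \<A>" and "\<A> \<noteq> {}"
    and "matrix_norm N"
  shows "joint_spectral_radius N \<A> < 1 \<longleftrightarrow>
    (\<exists>(d::nat) (V :: real^'n \<Rightarrow> real). GE_norm d V \<and> contracting \<A> V)"
proof
  assume "joint_spectral_radius N \<A> < 1"
  then obtain C \<gamma> where C: "0 < C" "0 \<le> \<gamma>" "\<gamma> < 1"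
    "\<And>w. set w \<subseteq> \<A> \<Longrightarrow> N (word_prod w) \<le> C * \<gamma> ^ length w"
    using joint_spectral_radius_less_1_iff[OF assms] by blast
  obtain K where K: "0 < K" "\<And>M x. norm (M *v x) \<le> K * N M * norm x"
    using matrix_norm_vector_mult_bound[OF assms(3)] by blast
  have "norm (word_prod w *v x) \<le> (K * C) * \<gamma> ^ length w * norm x" if "set w \<subseteq> \<A>" for w x
  proof -
    have "norm (word_prod w *v x) \<le> K * N (word_prod w) * norm x" by (rule K(2))
    also have "\<dots> \<le> K * (C * \<gamma> ^ length w) * norm x"
      using K(1) C(4)[OF that] by (intro mult_right_mono mult_left_mono) auto
    finally show ?thesis by (simp add: mult.assoc)
  qed
  then show "\<exists>d (V :: real^'n \<Rightarrow> real). GE_norm d V \<and> contracting \<A> V"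
    using exponential_decay_imp_contracting_GE_norm[OF assms(1) _ C(2,3), of "K * C"] K(1) C(1)
    by simp
next
  assume "\<exists>(d::nat) (V :: real^'n \<Rightarrow> real). GE_norm d V \<and> contracting \<A> V"
  then show "joint_spectral_radius N \<A> < 1"
    using contracting_GE_norm_imp_joint_spectral_radius_less_1[OF assms] by blast
qed

end
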